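(* Let $N,M$ be positive integers, let $\mathcal A,\mathcal M\in\mathbb C^{N\times N}$ with $\mathcal A$ Hermitian positive semi-definite and $\mathcal M$ Hermitian positive definite, let $\mathcal B\in\mathbb C^{N\times M}$ satisfy $\mathcal A\mathcal M^{-1}\mathcal B=0$, let $\mathcal U\in\mathbb C^{M\times M}$ be Hermitian positive definite, let $c>0$ be real, let $\mathcal F\in\mathbb C^N$ and let $0\neq\mathcal G\in\operatorname{Im}\mathcal B^*\subset\mathbb C^M$. Suppose $\dim\mathbb C_0\neq 0$, and let $\mathcal H\in\mathbb C^{N\times\dim\mathbb C_0}$ be a matrix whose columns form an $\mathcal M$-orthonormal basis of $\mathbb C_0$ (equivalently, of the eigenspace for the zero eigenvalue of $(\mathcal A+\mathcal B\mathcal U\mathcal B^* )u=\lambda\mathcal M u$). Then the constrained system $$(\mathcal A+c\mathcal M)u+\mathcal B p=\mathcal F,\qquad \mathcal B^* u=\mathcal G\qquad (u\in\mathbb C^N,\ p\in\mathbb C^M)$$ has a solution $(u,p)$ whose component $u$ is unique, and this $u$ is obtained as follows: there are unique $u_g,\tilde u\in\mathbb C^N$ with $$(\mathcal A+\mathcal B\mathcal U\mathcal B^*+\mathcal M\mathcal H\mathcal H^*\mathcal M)u_g=\mathcal B\mathcal U\mathcal G,\qquad (\mathcal A+\mathcal B\mathcal U\mathcal B^*+\mathcal M\mathcal H\mathcal H^*\mathcal M)\tilde u=\mathcal F,$$ and then $u$ is the unique solution in $\mathbb C^N$ of $$(\mathcal A+\mathcal B\mathcal U\mathcal B^*+c\mathcal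 M)u=\mathcal F-\mathcal B\mathcal U\mathcal B^*\tilde u+\mathcal B\mathcal U\mathcal G+c\mathcal M u_g.$$
   Context: $X^*$ denotes the conjugate transpose of a matrix $X$. $\mathbb C_0:=\operatorname{Ker}\mathcal A\cap\operatorname{Ker}(\mathcal B\mathcal U\mathcal B^* )\subset\mathbb C^N$. $\mathcal M$-orthonormal means orthonormal for the inner product $(v,w)\mapsto w^*\mathcal M v$, i.e. $\mathcal H^*\mathcal M\mathcal H=I$. *)

theory Defs
  imports "HOL-Analysis.Analysis"
begin

definition conj_transpose :: "complex^'m^'n \<Rightarrow> complex^'n^'m" where
  "conj_transpose X = (\<chi> i j. cnj (X $ j $ i))"

definition hermitian :: "complex^'n^'n \<Rightarrow> bool" where
  "hermitian X \<longleftrightarrow> conj_transpose X = X"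

text \<open>The form \<open>w\<^sup>* X v\<close>, linear in \<open>v\<close> and conjugate-linear in \<open>w\<close>.\<close>

definition sesq_form :: "complex^'n^'n \<Rightarrow> complex^'n \<Rightarrow> complex^'n \<Rightarrow> complex" where
  "sesq_form X v w = (\<Sum>i\<in>UNIV. cnj (w $ i) * (X *v v) $ i)"

text \<open>For Hermitian \<open>X\<close> the value \<open>v\<^sup>* X v\<close> is real, so taking its real part loses nothing.\<close>

definition hermitian_psd :: "complex^'n^'n \<Rightarrow> bool" where
  "hermitian_psd X \<longleftrightarrow> hermitian X \<and> (\<forall>v. 0 \<le> Re (sesq_form X v v))"

definition hermitian_pd :: "complex^'n^'n \<Rightarrow> bool" where
  "hermitian_pd X \<longleftrightarrow> hermitian X \<and> (\<forall>v. v \<noteq> 0 \<longrightarrow> 0 < Re (sesq_form X v v))"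

definition mat_Ker :: "complex^'m^'n \<Rightarrow> (complex^'m) set" where
  "mat_Ker X = {v. X *v v = 0}"

definition mat_Im :: "complex^'m^'n \<Rightarrow> (complex^'n) set" where
  "mat_Im X = range (\<lambda>v. X *v v)"

definition C0 ::
  "complex^'n^'n \<Rightarrow> complex^'m^'n \<Rightarrow> complex^'m^'m \<Rightarrow> (complex^'n) set" where
  "C0 A B U = mat_Ker A \<inter> mat_Ker (B ** U ** conj_transpose B)"

definition gen_eigenspace ::
  "complex^'n^'n \<Rightarrow> complex^'n^'n \<Rightarrow> complex \<Rightarrow> (complex^'n) set" where
  "gen_eigenspace K M \<mu> = {u. K *v u = \<mu> *s (M *v u)}"

text \<open>The constants \<open>vec.independent\<close>, \<open>vec.span\<close> and \<open>vec.dim\<close> refer to the scalar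
  multiplication \<open>*s\<close>, hence here to linear algebra over the complex numbers.\<close>

definition orthonormal_basis_columns ::
  "complex^'n^'n \<Rightarrow> complex^'k^'n \<Rightarrow> (complex^'n) set \<Rightarrow> bool" where
  "orthonormal_basis_columns M H S \<longleftrightarrow>
     conj_transpose H ** M ** H = mat 1 \<and>
     inj (\<lambda>j. column j H) \<and> vec.independent (columns H) \<and> vec.span (columns H) = S"

end

theory Submission
  imports Defs
begin

text \<open>With \<open>P = B U B\<^sup>*\<close> and \<open>Q = M H H\<^sup>* M\<close>, the condition \<open>A M\<^sup>-\<^sup>1 B = 0\<close> makes the images of \<open>M\<^sup>-\<^sup>1 A\<close>, \<open>M\<^sup>-\<^sup>1 P\<close> and \<open>M\<^sup>-\<^sup>1 Q\<close>
  mutually \<open>M\<close>-orthogonal. Hence \<open>(A + P + Q) x = r\<close> splits: applying \<open>A M\<^sup>-\<^sup>1\<close> and \<open>H\<^sup>*\<close> shows that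
  if these annihilate \<open>r\<close>, then \<open>A x = 0\<close>, \<open>H\<^sup>* M x = 0\<close> and \<open>P x = r\<close>. With \<open>r = 0\<close> this gives invertibility,
  with \<open>r = B U G\<close> it gives \<open>B\<^sup>* u\<^sub>g = G\<close>, and with \<open>r = M u\<^sub>g\<close> it places \<open>M u\<^sub>g\<close> in the image of \<open>B\<close>.
  Applying \<open>P M\<^sup>-\<^sup>1\<close> to the final equation shows that its solution satisfies the constraint, after which
  the multiplier \<open>p\<close> can be read off.\<close>

section \<open>The complex inner product, adjoints and positive definite matrices\<close>

definition cdot :: "complex^'n \<Rightarrow> complex^'n \<Rightarrow> complex" where
  "cdot x y = (\<Sum>i\<in>UNIV. cnj (x $ i) * y $ i)"

lemma sesq_form_eq_cdot: "sesq_form X v w = cdot w (X *v v)"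
  by (simp add: sesq_form_def cdot_def)

lemma cdot_add_right: "cdot x (y + z) = cdot x y + cdot x z"
  by (simp add: cdot_def sum.distrib algebra_simps)

lemma cdot_zero_right [simp]: "cdot x 0 = 0"
  and cdot_zero_left [simp]: "cdot 0 x = 0"
  by (simp_all add: cdot_def)

lemma cdot_scaleR_right: "cdot x (c *\<^sub>R y) = c *\<^sub>R cdot x y"
  by (simp add: cdot_def scaleR_sum_right)

lemma cdot_self_eq_0: "cdot x x = 0 \<longleftrightarrow> x = 0"
proof
  assume "cdot x x = 0"
  then have "(\<Sum>i\<in>UNIV. (cmod (x $ i))\<^sup>2) = 0"
    by (simp add: cdot_def mult.commute[of "cnj _"] complex_norm_square[symmetric]
        flip: of_real_power of_real_sum)
  then show "x = 0"
    by (simp add: sum_nonneg_eq_0_iff vec_eq_iff)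
qed simp

lemma cdot_adjoint: "cdot x (X *v y) = cdot (conj_transpose X *v x) y"
proof -
  have "cdot x (X *v y) = (\<Sum>i\<in>UNIV. \<Sum>j\<in>UNIV. cnj (x $ i) * (X $ i $ j * y $ j))"
    by (simp add: cdot_def matrix_vector_mult_def sum_distrib_left)
  also have "\<dots> = (\<Sum>j\<in>UNIV. \<Sum>i\<in>UNIV. cnj (x $ i) * (X $ i $ j * y $ j))"
    by (rule sum.swap)
  also have "\<dots> = cdot (conj_transpose X *v x) y"
    by (auto simp: cdot_def matrix_vector_mult_def conj_transpose_def sum_distrib_left
        sum_distrib_right ac_simps intro!: sum.cong)
  finally show ?thesis .
qed

lemma conj_transpose_conj_transpose [simp]: "conj_transpose (conj_transpose X) = X"
  by (simp add: conj_transpose_def vec_eq_iff)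

lemma cdot_adjoint': "cdot x (conj_transpose X *v y) = cdot (X *v x) y"
  by (simp add: cdot_adjoint)

lemma hermitian_cdot: "hermitian X \<Longrightarrow> cdot x (X *v y) = cdot (X *v x) y"
  by (simp add: cdot_adjoint hermitian_def)

lemma hermitian_pd_cdot_pos: "hermitian_pd X \<Longrightarrow> v \<noteq> 0 \<Longrightarrow> 0 < Re (cdot v (X *v v))"
  by (simp add: hermitian_pd_def sesq_form_eq_cdot)

lemma hermitian_pd_cdot_nonneg: "hermitian_pd X \<Longrightarrow> 0 \<le> Re (cdot v (X *v v))"
  by (cases "v = 0") (auto dest: hermitian_pd_cdot_pos)

lemma hermitian_pd_cdot_eq_0: "hermitian_pd X \<Longrightarrow> Re (cdot v (X *v v)) \<le> 0 \<Longrightarrow> v = 0"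
  using hermitian_pd_cdot_pos by fastforce

lemma scaleR_matrix_vector_mult: "(c *\<^sub>R X) *v v = c *\<^sub>R (X *v (v :: complex^'n))"
  by (simp add: matrix_vector_mult_def vec_eq_iff scaleR_sum_right)

text \<open>For square matrices a left inverse is also a right inverse, so injectivity already gives
  surjectivity.\<close>

lemma kernel_trivial_imp_bij:
  fixes X :: "'a::field^'n^'n"
  assumes "\<And>v. X *v v = 0 \<Longrightarrow> v = 0"
  shows "bij ((*v) X)"
proof -
  have inj: "inj ((*v) X)"
  proof (rule injI)
    fix x y assume "X *v x = X *v y"
    then have "X *v (x - y) = 0"
      by (simp add: matrix_vector_mult_diff_distrib)
    then show "x = y"
      using assms by fastforce
  qed
  then have "\<exists>Y. X ** Y = mat 1"
    by (simp only: flip: matrix_left_invertible_injective matrix_left_right_inverse)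
  then have "surj ((*v) X)"
    by (simp only: matrix_right_invertible_surjective)
  with inj show ?thesis
    by (simp add: bij_def)
qed

lemma hermitian_pd_imp_bij: "hermitian_pd X \<Longrightarrow> bij ((*v) X)"
  by (rule kernel_trivial_imp_bij) (auto dest: hermitian_pd_cdot_pos)

lemma hermitian_pd_inverse_apply:
  assumes "hermitian_pd X"
  shows "X *v (matrix_inv X *v v) = v"
proof -
  have "invertible X"
    using hermitian_pd_imp_bij[OF assms]
    by (metis bij_is_inj invertible_left_inverse matrix_left_invertible_injective)
  then show ?thesis
    unfolding matrix_inv_def invertible_def
    by (metis (mono_tags, lifting) matrix_vector_mul_assoc matrix_vector_mul_lid someI_ex)
qed

text \<open>With \<open>w = B\<^sup>* v\<close> the form of \<open>B U B\<^sup>*\<close> at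
  \<open>v\<close> is \<open>w\<^sup>* U w\<close>, so definiteness of \<open>U\<close> forces
  \<open>w = 0\<close>.\<close>

lemma mat_Ker_gram:
  assumes "hermitian_pd U"
  shows "mat_Ker (B ** U ** conj_transpose B) = mat_Ker (conj_transpose B)"
proof -
  have "conj_transpose B *v v = 0" if "(B ** U ** conj_transpose B) *v v = 0" for v
  proof -
    have "cdot (conj_transpose B *v v) (U *v (conj_transpose B *v v))
        = cdot v ((B ** U ** conj_transpose B) *v v)"
      by (simp add: cdot_adjoint flip: matrix_vector_mul_assoc)
    with that show ?thesis
      by (intro hermitian_pd_cdot_eq_0[OF assms]) simp
  qed
  then show ?thesis
    by (auto simp: mat_Ker_def simp flip: matrix_vector_mul_assoc)
qed

lemma span_columns_subset_range:
  fixes H :: "'a::field^'k^'n"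
  shows "vec.span (columns H) \<subseteq> range ((*v) H)"
proof (rule vec.span_minimal)
  show "columns H \<subseteq> range ((*v) H)"
  proof -
    have "column i H = H *v axis i 1" for i
      by (simp add: vec_eq_iff column_def matrix_vector_mult_def axis_def if_distrib cong: if_cong)
    then show ?thesis
      by (auto simp: columns_def)
  qed
  show "vec.subspace (range ((*v) H))"
    using vec.subspace_UNIV
    by (intro vec.linear_subspace_image) (auto simp: matrix_vector_mul_linear_gen)
qed

section \<open>Consequences of the orthogonality relation
  \<open>A M\<^sup>-\<^sup>1 B = 0\<close>\<close>

locale weighted_orthogonal =
  fixes A M :: "complex^'n^'n"
    and B :: "complex^'m^'n"
    and U :: "complex^'m^'m"
  assumes A: "hermitian_psd A"
    and M: "hermitian_pd M"
    and AMB: "A ** matrix_inv M ** B = 0"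
    and U: "hermitian_pd U"
begin

abbreviation "P \<equiv> B ** U ** conj_transpose B"

lemma hermitian_A: "hermitian A" and hermitian_M: "hermitian M" and hermitian_U: "hermitian U"
  using A M U by (auto simp: hermitian_psd_def hermitian_pd_def)

lemma P_apply: "P *v x = B *v (U *v (conj_transpose B *v x))"
  by (simp add: matrix_vector_mul_assoc matrix_mul_assoc)

lemma P_eq_0_iff: "P *v x = 0 \<longleftrightarrow> conj_transpose B *v x = 0"
  using mat_Ker_gram[OF U, of B] by (auto simp: mat_Ker_def)

lemma cdot_P: "cdot x (P *v y) = cdot (P *v x) y"
  by (simp add: P_apply cdot_adjoint cdot_adjoint' hermitian_cdot[OF hermitian_U]
      hermitian_U[unfolded hermitian_def])

lemma M_inv_apply: "M *v (matrix_inv M *v x) = x"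
  by (rule hermitian_pd_inverse_apply[OF M])

lemma inv_M_apply: "matrix_inv M *v (M *v x) = x"
  using bij_is_inj[OF hermitian_pd_imp_bij[OF M]] M_inv_apply by (metis injD)

lemma A_inv_M_B: "A *v (matrix_inv M *v (B *v x)) = 0"
  using AMB by (metis matrix_vector_mul_assoc matrix_vector_mult_0)

text \<open>The adjoint of \<open>A_inv_M_B\<close>, obtained by showing that \<open>?w\<close> has
  zero norm.\<close>

lemma B_inv_M_A: "conj_transpose B *v (matrix_inv M *v (A *v x)) = 0" (is "?w = 0")
proof -
  let ?y = "matrix_inv M *v (B *v ?w)"
  \<comment> \<open>Writing \<open>B *v ?w\<close> as \<open>M *v ?y\<close> lets the Hermitian
    matrix \<open>M\<close> move across and cancel its own inverse.\<close>
  have "cdot ?w ?w = cdot (M *v ?y) (matrix_inv M *v (A *v x))"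
    by (simp add: cdot_adjoint' M_inv_apply)
  also have "\<dots> = cdot ?y (A *v x)"
    using hermitian_cdot[OF hermitian_M, of ?y "matrix_inv M *v (A *v x)"] by (simp add: M_inv_apply)
  also have "\<dots> = 0"
    by (simp add: hermitian_cdot[OF hermitian_A] A_inv_M_B)
  finally show ?thesis
    by (simp add: cdot_self_eq_0)
qed

text \<open>For \<open>z = M\<^sup>-\<^sup>1 A x\<close> the squared \<open>M\<close>-norm
  \<open>z\<^sup>* M z\<close> equals \<open>(A z)\<^sup>* x\<close>, and
  \<open>A z = 0\<close>.\<close>

lemma A_inv_M_A_eq_0:
  assumes "A *v (matrix_inv M *v (A *v x)) = 0"
  shows "A *v x = 0"
proof -
  let ?z = "matrix_inv M *v (A *v x)"
  have "cdot ?z (M *v ?z) = cdot (A *v ?z) x"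
    by (simp add: M_inv_apply hermitian_cdot[OF hermitian_A])
  with assms have "?z = 0"
    by (intro hermitian_pd_cdot_eq_0[OF M]) simp
  then show ?thesis
    using M_inv_apply[of "A *v x"] by simp
qed

text \<open>Applying \<open>A M\<^sup>-\<^sup>1\<close> removes the \<open>P\<close> term and leaves
  the situation of \<open>A_inv_M_A_eq_0\<close>.\<close>

lemma kernel_sum:
  assumes "(A + P) *v x = 0"
  shows "A *v x = 0" "P *v x = 0"
proof -
  have "A *v (matrix_inv M *v ((A + P) *v x)) = A *v (matrix_inv M *v (A *v x))"
    by (simp add: matrix_vector_mult_add_rdistrib matrix_vector_right_distrib P_apply A_inv_M_B)
  with assms have "A *v (matrix_inv M *v (A *v x)) = 0"
    by simp
  then show "A *v x = 0"
    by (rule A_inv_M_A_eq_0)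
  with assms show "P *v x = 0"
    by (simp add: matrix_vector_mult_add_rdistrib)
qed

lemma C0_eq_gen_eigenspace: "C0 A B U = gen_eigenspace (A + P) M 0"
  using kernel_sum by (auto simp: C0_def gen_eigenspace_def mat_Ker_def matrix_vector_mult_add_rdistrib)

section \<open>Positivity of the shifted matrices and uniqueness for the constrained system\<close>

lemma cdot_shift_pos:
  assumes "c > 0" "v \<noteq> 0"
  shows "0 < Re (cdot v ((A + c *\<^sub>R M) *v v))"
proof -
  have "0 \<le> Re (cdot v (A *v v))"
    using A by (simp add: hermitian_psd_def sesq_form_eq_cdot)
  with assms hermitian_pd_cdot_pos[OF M] show ?thesis
    by (simp add: matrix_vector_mult_add_rdistrib scaleR_matrix_vector_mult cdot_add_right
        cdot_scaleR_right add_nonneg_pos)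
qed

lemma cdot_P_nonneg: "0 \<le> Re (cdot v (P *v v))"
  using hermitian_pd_cdot_nonneg[OF U] by (simp add: P_apply cdot_adjoint[of _ B])

lemma cdot_P_le_0: "Re (cdot v (P *v v)) \<le> 0 \<Longrightarrow> conj_transpose B *v v = 0"
  by (rule hermitian_pd_cdot_eq_0[OF U]) (simp add: P_apply cdot_adjoint[of _ B])

lemma bij_shift:
  assumes "c > 0"
  shows "bij ((*v) (A + P + c *\<^sub>R M))"
proof (rule kernel_trivial_imp_bij)
  fix v assume 0: "(A + P + c *\<^sub>R M) *v v = 0"
  have "cdot v ((A + P + c *\<^sub>R M) *v v) = cdot v ((A + c *\<^sub>R M) *v v) + cdot v (P *v v)"
    by (simp add: matrix_vector_mult_add_rdistrib cdot_add_right)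
  then show "v = 0"
    using 0 cdot_shift_pos[OF assms, of v] cdot_P_nonneg[of v] by (auto simp: complex_eq_iff)
qed

text \<open>The difference \<open>u - v\<close> lies in the kernel of \<open>B\<^sup>*\<close>, so
  it is orthogonal to the image of \<open>B\<close>, which contains
  \<open>(A + c M) (u - v)\<close>. Definiteness of \<open>A + c M\<close> then makes it
  vanish.\<close>

lemma saddle_point_unique:
  assumes "c > 0"
    and "(A + c *\<^sub>R M) *v u + B *v p = F" "conj_transpose B *v u = G"
    and "(A + c *\<^sub>R M) *v v + B *v q = F" "conj_transpose B *v v = G"
  shows "u = v"
proof (rule ccontr)
  assume "u \<noteq> v"
  have "(A + c *\<^sub>R M) *v (u - v) = B *v (q - p)"
    using assms(2,4) by (simp add: matrix_vector_mult_diff_distrib algebra_simps)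
  then have "cdot (u - v) ((A + c *\<^sub>R M) *v (u - v))
      = cdot (conj_transpose B *v (u - v)) (q - p)"
    by (simp only: cdot_adjoint[of _ B])
  also have "\<dots> = 0"
    using assms(3,5) by (simp add: matrix_vector_mult_diff_distrib)
  finally show False
    using cdot_shift_pos[OF assms(1), of "u - v"] \<open>u \<noteq> v\<close> by simp
qed

end

section \<open>The augmented matrix \<open>A + P + Q\<close>\<close>

locale weighted_orthogonal_basis = weighted_orthogonal A M B U
  for A M :: "complex^'n^'n" and B :: "complex^'m^'n" and U :: "complex^'m^'m" +
  fixes H :: "complex^'k^'n"
  assumes H: "orthonormal_basis_columns M H (C0 A B U)"
begin

abbreviation "Q \<equiv> M ** H ** conj_transpose H ** M"

lemma Q_apply: "Q *v x = M *v (H *v (conj_transpose H *v (M *v x)))"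
  by (simp add: matrix_vector_mul_assoc matrix_mul_assoc)

lemma H_orthonormal: "conj_transpose H *v (M *v (H *v y)) = y"
proof -
  have "(conj_transpose H ** M ** H) *v y = y"
    using H by (simp add: orthonormal_basis_columns_def)
  then show ?thesis
    by (simp flip: matrix_vector_mul_assoc)
qed

lemma range_H: "range ((*v) H) = C0 A B U"
proof -
  have "H *v y \<in> vec.span (columns H)" for y
    unfolding matrix_mult_sum
    by (intro vec.span_sum vec.span_scale vec.span_base) (auto simp: columns_def)
  with span_columns_subset_range[of H] H show ?thesis
    by (auto simp: orthonormal_basis_columns_def)
qed

lemma A_H: "A *v (H *v y) = 0" and P_H: "P *v (H *v y) = 0"
  using range_H by (auto simp: C0_def mat_Ker_def)

lemma B_H: "conj_transpose B *v (H *v y) = 0"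
  using P_H P_eq_0_iff by blast

lemma H_A: "conj_transpose H *v (A *v x) = 0" (is "?w = 0")
proof -
  have "cdot ?w ?w = cdot (A *v (H *v ?w)) x"
    by (simp add: cdot_adjoint' hermitian_cdot[OF hermitian_A])
  then show ?thesis
    by (simp add: A_H cdot_self_eq_0)
qed

lemma H_B: "conj_transpose H *v (B *v x) = 0" (is "?w = 0")
proof -
  have "cdot ?w ?w = cdot (conj_transpose B *v (H *v ?w)) x"
    by (simp add: cdot_adjoint[of _ B] cdot_adjoint'[of _ H])
  then show ?thesis
    by (simp add: B_H cdot_self_eq_0)
qed

lemma augmented_split:
  assumes eq: "(A + P + Q) *v x = r"
    and Ar: "A *v (matrix_inv M *v r) = 0" and Hr: "conj_transpose H *v r = 0"
  shows "A *v x = 0" "conj_transpose H *v (M *v x) = 0" "P *v x = r"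
proof -
  have sum: "A *v x + P *v x + Q *v x = r"
    using eq by (simp add: matrix_vector_mult_add_rdistrib)
  \<comment> \<open>\<open>A M\<^sup>-\<^sup>1\<close> kills \<open>P x\<close> by
    \<open>A_inv_M_B\<close>, and \<open>Q x\<close> because \<open>A H = 0\<close>.\<close>
  have "A *v (matrix_inv M *v r) = A *v (matrix_inv M *v (A *v x))"
    by (simp add: matrix_vector_right_distrib P_apply Q_apply A_inv_M_B inv_M_apply A_H flip: sum)
  with Ar have "A *v (matrix_inv M *v (A *v x)) = 0"
    by simp
  then show Ax: "A *v x = 0"
    by (rule A_inv_M_A_eq_0)
  \<comment> \<open>\<open>H\<^sup>*\<close> kills \<open>A x\<close> and \<open>P x\<close>, while
    \<open>H\<^sup>* M H = 1\<close> reduces \<open>H\<^sup>* Q x\<close> to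
    \<open>H\<^sup>* M x\<close>.\<close>
  have "conj_transpose H *v r = conj_transpose H *v (M *v x)"
    by (simp add: matrix_vector_right_distrib P_apply Q_apply H_A H_B H_orthonormal flip: sum)
  with Hr show Hx: "conj_transpose H *v (M *v x) = 0"
    by simp
  from sum show "P *v x = r"
    by (simp add: Ax Q_apply Hx)
qed

lemma bij_augmented: "bij ((*v) (A + P + Q))"
proof (rule kernel_trivial_imp_bij)
  fix x assume "(A + P + Q) *v x = 0"
  note split = augmented_split[OF this]
  \<comment> \<open>A kernel vector lies in \<open>C0 A B U\<close>, hence is some
    \<open>H y\<close>; being \<open>M\<close>-orthogonal to the columns of \<open>H\<close>, it has
    \<open>y = 0\<close>.\<close>
  then have "x \<in> range ((*v) H)"
    by (auto simp: range_H C0_def mat_Ker_def)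
  then obtain y where "x = H *v y" ..
  with split(2) show "x = 0"
    by (simp add: H_orthonormal)
qed

lemma augmented_solution_BUG:
  assumes "G \<in> mat_Im (conj_transpose B)" and "(A + P + Q) *v ug = B *v (U *v G)"
  shows "A *v ug = 0" "conj_transpose H *v (M *v ug) = 0" "conj_transpose B *v ug = G"
proof -
  note split = augmented_split[OF assms(2) A_inv_M_B H_B]
  from split(1,2) show "A *v ug = 0" "conj_transpose H *v (M *v ug) = 0" .
  obtain w where w: "G = conj_transpose B *v w"
    using assms(1) by (auto simp: mat_Im_def)
  \<comment> \<open>Here \<open>B U G = P w\<close>, and \<open>P\<close> has the same kernel as
    \<open>B\<^sup>*\<close>.\<close>
  have "P *v (ug - w) = 0"
    using split(3) by (simp add: matrix_vector_mult_diff_distrib P_apply w)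
  then have "conj_transpose B *v (ug - w) = 0"
    by (simp only: P_eq_0_iff)
  then show "conj_transpose B *v ug = G"
    by (simp add: w matrix_vector_mult_diff_distrib)
qed

text \<open>The augmented system with right-hand side \<open>M x\<close> collapses to
  \<open>P y = M x\<close>, so \<open>q = U B\<^sup>* y\<close> works. Applied to \<open>ug\<close>,
  this lets \<open>c M ug\<close> be absorbed into the multiplier.\<close>

lemma augmented_solution_in_range:
  assumes "A *v x = 0" "conj_transpose H *v (M *v x) = 0"
  obtains q where "M *v x = B *v q"
proof -
  obtain y where y: "(A + P + Q) *v y = M *v x"
    using bij_is_surj[OF bij_augmented] by (metis surjD)
  have "P *v y = M *v x"
    using augmented_split(3)[OF y] assms by (simp add: inv_M_apply)
  then show thesis
    using that P_apply by metis
qed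

section \<open>From the reduced equation to the constrained system\<close>

lemma reduced_solution:
  assumes "c > 0" "G \<in> mat_Im (conj_transpose B)"
    and ug: "(A + P + Q) *v ug = B *v (U *v G)" and ut: "(A + P + Q) *v ut = F"
    and v: "(A + P + c *\<^sub>R M) *v v = F - P *v ut + B *v (U *v G) + c *\<^sub>R (M *v ug)"
  shows "conj_transpose B *v v = G" "\<exists>p. (A + c *\<^sub>R M) *v v + B *v p = F"
proof -
  note ug_props = augmented_solution_BUG[OF assms(2) ug]
  define d where "d = v - ug"
  have P_ug: "P *v ug = B *v (U *v G)"
    by (simp add: P_apply ug_props)
  \<comment> \<open>Inserting \<open>F = (A + P + Q) ut\<close> and \<open>A ug = 0\<close> gives an
    equation for \<open>d\<close>, whose image under \<open>B\<^sup>*\<close> is the error in the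
    constraint.\<close>
  have "A *v d + P *v d + c *\<^sub>R (M *v d) = A *v ut + Q *v ut"
    using v ut[symmetric] P_ug ug_props(1)
    by (simp add: d_def matrix_vector_mult_add_rdistrib scaleR_matrix_vector_mult
        matrix_vector_mult_diff_distrib algebra_simps)
  then have "P *v (matrix_inv M *v (A *v d + P *v d + M *v (c *\<^sub>R d)))
      = P *v (matrix_inv M *v (A *v ut + Q *v ut))"
    by (simp add: linear_scale[OF matrix_vector_mul_linear])
  \<comment> \<open>\<open>P M\<^sup>-\<^sup>1\<close> annihilates \<open>A d\<close>,
    \<open>A ut\<close> and \<open>Q ut\<close>, so \<open>ut\<close> disappears.\<close>
  then have "P *v (matrix_inv M *v (P *v d)) + P *v (c *\<^sub>R d) = 0"
    by (simp add: matrix_vector_right_distrib P_apply Q_apply B_inv_M_A inv_M_apply B_H)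
  then have "P *v (matrix_inv M *v (P *v d)) + c *\<^sub>R (P *v d) = 0"
    by (simp add: linear_scale[OF matrix_vector_mul_linear])
  then have "cdot d (P *v (matrix_inv M *v (P *v d))) + c *\<^sub>R cdot d (P *v d) = 0"
    by (metis cdot_add_right cdot_scaleR_right cdot_zero_right)
  \<comment> \<open>With \<open>z = M\<^sup>-\<^sup>1 P d\<close> this term is
    \<open>z\<^sup>* M z\<close>. Two nonnegative terms then sum to zero, which forces
    \<open>B\<^sup>* d = 0\<close>.\<close>
  moreover have "0 \<le> Re (cdot d (P *v (matrix_inv M *v (P *v d))))"
  proof -
    let ?z = "matrix_inv M *v (P *v d)"
    have "cdot d (P *v ?z) = cdot (M *v ?z) ?z"
      by (simp only: cdot_P M_inv_apply)
    then show ?thesis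
      using hermitian_pd_cdot_nonneg[OF M, of ?z] by (simp only: hermitian_cdot[OF hermitian_M])
  qed
  ultimately have "c * Re (cdot d (P *v d)) \<le> 0"
    by (simp add: complex_eq_iff)
  then have Bd: "conj_transpose B *v d = 0"
    using \<open>c > 0\<close> by (intro cdot_P_le_0) (simp add: mult_le_0_iff)
  then show Bv: "conj_transpose B *v v = G"
    using ug_props(3) by (simp add: d_def matrix_vector_mult_diff_distrib)
  obtain q where q: "M *v ug = B *v q"
    using augmented_solution_in_range ug_props(1,2) .
  \<comment> \<open>Since \<open>B\<^sup>* v = G\<close>, the term \<open>P v\<close> cancels
    \<open>B U G\<close>. The multiplier read off is
    \<open>p = U B\<^sup>* ut - c q\<close>.\<close>
  have "(A + c *\<^sub>R M) *v v + B *v (U *v (conj_transpose B *v ut)) - c *\<^sub>R (B *v q) = F"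
    using v by (simp add: matrix_vector_mult_add_rdistrib P_apply Bv q algebra_simps)
  then have "(A + c *\<^sub>R M) *v v + B *v (U *v (conj_transpose B *v ut) - c *\<^sub>R q) = F"
    by (simp add: matrix_vector_mult_diff_distrib linear_scale[OF matrix_vector_mul_linear]
        algebra_simps)
  then show "\<exists>p. (A + c *\<^sub>R M) *v v + B *v p = F" ..
qed

end

theorem mainTheorem8:
  fixes A M :: "complex^'n^'n"
    and B :: "complex^'m^'n"
    and U :: "complex^'m^'m"
    and c :: real
    and F :: "complex^'n"
    and G :: "complex^'m"
    and H :: "complex^'k^'n"
  assumes "hermitian_psd A"
    and "hermitian_pd M"
    and "A ** matrix_inv M ** B = 0"
    and "hermitian_pd U"
    and "c > 0"
    and "G \<noteq> 0"
    and "G \<in> mat_Im (conj_transpose B)"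
    and "vec.dim (C0 A B U) \<noteq> 0"
    and "CARD('k) = vec.dim (C0 A B U)"
    and "orthonormal_basis_columns M H (C0 A B U)"
  defines "K \<equiv> A + B ** U ** conj_transpose B"
    and "S \<equiv> A + B ** U ** conj_transpose B + M ** H ** conj_transpose H ** M"
  shows "C0 A B U = gen_eigenspace K M 0
    \<and> (\<exists>!u. \<exists>p. (A + c *\<^sub>R M) *v u + B *v p = F \<and> conj_transpose B *v u = G)
    \<and> (\<exists>!ug. S *v ug = B *v (U *v G))
    \<and> (\<exists>!ut. S *v ut = F)
    \<and> (\<forall>u p ug ut.
          (A + c *\<^sub>R M) *v u + B *v p = F \<and> conj_transpose B *v u = G
          \<and> S *v ug = B *v (U *v G) \<and> S *v ut = F \<longrightarrow>
          (\<forall>v. (K + c *\<^sub>R M) *v v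
                 = F - (B ** U ** conj_transpose B) *v ut + B *v (U *v G) + c *\<^sub>R (M *v ug)
               \<longleftrightarrow> v = u))"
proof -
  interpret weighted_orthogonal_basis A M B U H
    by (intro weighted_orthogonal_basis.intro weighted_orthogonal.intro
        weighted_orthogonal_basis_axioms.intro assms)
  let ?sys = "\<lambda>u p. (A + c *\<^sub>R M) *v u + B *v p = F \<and> conj_transpose B *v u = G"
  let ?rhs = "\<lambda>ug ut. F - (B ** U ** conj_transpose B) *v ut + B *v (U *v G) + c *\<^sub>R (M *v ug)"
  have S: "\<exists>!x. S *v x = r" for r
    using bij_augmented unfolding S_def bij_iff by blast
  have K: "\<exists>!x. (K + c *\<^sub>R M) *v x = r" for r
    using bij_shift[OF \<open>c > 0\<close>] unfolding K_def bij_iff by blast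
  have sol: "\<exists>p. ?sys v p"
    if "S *v ug = B *v (U *v G)" "S *v ut = F" "(K + c *\<^sub>R M) *v v = ?rhs ug ut" for v ug ut
    using reduced_solution[OF \<open>c > 0\<close> \<open>G \<in> _\<close> that[unfolded S_def K_def]] by blast
  have uniq: "u = v" if "?sys u p" "?sys v q" for u v p q
    using that by (elim conjE) (rule saddle_point_unique[OF \<open>c > 0\<close>])
  have ex1: "\<exists>!u. \<exists>p. ?sys u p"
  proof -
    obtain ug ut where "S *v ug = B *v (U *v G)" "S *v ut = F"
      using S by blast
    moreover obtain v where "(K + c *\<^sub>R M) *v v = ?rhs ug ut"
      using K by blast
    ultimately have "\<exists>p. ?sys v p"
      by (rule sol)
    with uniq show ?thesis
      by (intro ex1I[of _ v]) blast+
  qed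
  have iff: "(K + c *\<^sub>R M) *v v = ?rhs ug ut \<longleftrightarrow> v = u"
    if "?sys u p" "S *v ug = B *v (U *v G)" "S *v ut = F" for u p ug ut v
  proof -
    \<comment> \<open>Every solution of the reduced equation solves the constrained system, hence is
      \<open>u\<close>; the converse holds because the reduced equation does have a
      solution.\<close>
    have "w = u" if "(K + c *\<^sub>R M) *v w = ?rhs ug ut" for w
      using sol[OF \<open>S *v ug = _\<close> \<open>S *v ut = F\<close> that] uniq[OF \<open>?sys u p\<close>] by blast
    then show ?thesis
      using K[of "?rhs ug ut"] by blast
  qed
  show ?thesis
    using C0_eq_gen_eigenspace ex1 S iff unfolding K_def[symmetric]
    by (intro conjI allI impI; (elim conjE)?) simp_all
qed

end
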